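(* Let $U$ be a finite nonempty set and let $\mathbf{C}$ be a covering of $U$. If all the blocks of $\mathbf{C}$ are uniform blocks with respect to $\mathbf{C}$, then $Cov(\mathbf{C})$ is a partition of $U$.
   Context: A covering of $U$ is a family $\mathbf{C}$ of subsets of $U$ with $\emptyset\notin\mathbf{C}$ and $\bigcup\mathbf{C}=U$; its elements are called blocks. A partition of $U$ is a covering of $U$ whose distinct blocks are disjoint. For $x\in U$, the neighborhood of $x$ is $N(x)=\bigcap\{K\in\mathbf{C}\mid x\in K\}$, and $Cov(\mathbf{C})=\{N(x)\mid x\in U\}$ (a set of subsets of $U$, without repetition). The membership repeat degree of $x$ is $\partial(x)=|\{K\in\mathbf{C}\mid x\in K\}|$. A block $K\in\mathbf{C}$ is a uniform block with respect to $\mathbf{C}$ if all elements of $K$ have the same membership repeat degree, i.e. $\partial(x)=\partial(y)$ for all $x,y\in K$. *)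

theory Defs
  imports "HOL-Library.Disjoint_Sets"
begin

definition covering_on :: "'a set \<Rightarrow> 'a set set \<Rightarrow> bool" where
  "covering_on U C \<longleftrightarrow> {} \<notin> C \<and> \<Union>C = U"

text \<open>For \<open>x \<notin> \<Union>C\<close> this is \<open>UNIV\<close>, an intersection of no sets;
  it is only meant for points of the covered set.\<close>

definition neighborhood :: "'a set set \<Rightarrow> 'a \<Rightarrow> 'a set" where
  "neighborhood C x = \<Inter>{K \<in> C. x \<in> K}"

definition Cov :: "'a set \<Rightarrow> 'a set set \<Rightarrow> 'a set set" where
  "Cov U C = {neighborhood C x |x. x \<in> U}"

definition repeat_degree :: "'a set set \<Rightarrow> 'a \<Rightarrow> nat" where
  "repeat_degree C x = card {K \<in> C. x \<in> K}"

definition uniform_block :: "'a set set \<Rightarrow> 'a set \<Rightarrow> bool" where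
  "uniform_block C K \<longleftrightarrow>
     K \<in> C \<and> (\<forall>x\<in>K. \<forall>y\<in>K. repeat_degree C x = repeat_degree C y)"

end

theory Submission
  imports Defs
begin

text \<open>If \<open>y \<in> N(x)\<close>, every block containing \<open>x\<close> contains \<open>y\<close>. As \<open>x\<close> and \<open>y\<close> share a uniform
  block, they lie in equally many blocks, so by finiteness in the same blocks, and \<open>N(y) = N(x)\<close>.
  Hence two neighborhoods with a common point coincide.\<close>

text \<open>If no block contains \<open>x\<close>, the intersection is \<open>UNIV\<close>, which
  still contains \<open>x\<close>. Used both to see that the neighborhoods cover \<open>U\<close>
  and that none is empty.\<close>

lemma mem_neighborhood_self: "x \<in> neighborhood C x"
  by (auto simp: neighborhood_def)

lemma neighborhood_eqI:
  assumes "finite C" and "x \<in> \<Union>C"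
    and "\<forall>K\<in>C. uniform_block C K"
    and y: "y \<in> neighborhood C x"
  shows "neighborhood C y = neighborhood C x"
proof -
  obtain K where K: "K \<in> C" "x \<in> K"
    using \<open>x \<in> \<Union>C\<close> by blast
  have sub: "{K \<in> C. x \<in> K} \<subseteq> {K \<in> C. y \<in> K}"
    using y by (auto simp: neighborhood_def)
  have "y \<in> K"
    using sub K by blast
  then have card: "card {K \<in> C. x \<in> K} = card {K \<in> C. y \<in> K}"
    using assms(3) K unfolding uniform_block_def repeat_degree_def by blast
  \<comment> \<open>Inclusion and equal cardinality force equality because the larger family lies in
    the finite set \<open>C\<close>.\<close>
  have "{K \<in> C. x \<in> K} = {K \<in> C. y \<in> K}"
    by (rule card_subset_eq[OF _ sub card]) (simp add: \<open>finite C\<close>)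
  then show ?thesis
    unfolding neighborhood_def by (rule arg_cong[OF sym])
qed

theorem theorem21:
  fixes U :: "'a set" and C :: "'a set set"
  assumes "finite U" and "U \<noteq> {}"
    and "covering_on U C"
    and "\<forall>K\<in>C. uniform_block C K"
  shows "partition_on U (Cov U C)"
proof (rule partition_onI)
  have U: "\<Union>C = U"
    using assms(3) by (simp add: covering_on_def)
  \<comment> \<open>Blocks are subsets of the finite set \<open>U\<close>, so there are only
    finitely many.\<close>
  then have "finite C"
    using \<open>finite U\<close> finite_UnionD by blast
  show "\<Union>(Cov U C) = U"
  proof
    \<comment> \<open>The covering supplies a block through \<open>x\<close>, so the intersection is
      over a nonempty family and stays inside that block.\<close>
    have "neighborhood C x \<subseteq> U" if "x \<in> U" for x
    proof -
      obtain K where "K \<in> C" "x \<in> K"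
        using \<open>x \<in> U\<close> U by blast
      then have "neighborhood C x \<subseteq> K"
        unfolding neighborhood_def by blast
      also have "K \<subseteq> U"
        using \<open>K \<in> C\<close> U by blast
      finally show ?thesis .
    qed
    then show "\<Union>(Cov U C) \<subseteq> U"
      unfolding Cov_def by blast
    show "U \<subseteq> \<Union>(Cov U C)"
    proof
      fix x assume "x \<in> U"
      then have "neighborhood C x \<in> Cov U C"
        unfolding Cov_def by blast
      with mem_neighborhood_self[of x C] show "x \<in> \<Union>(Cov U C)"
        by (rule UnionI[rotated])
    qed
  qed
  show "disjnt p q" if pq: "p \<in> Cov U C" "q \<in> Cov U C" "p \<noteq> q" for p q
  proof -
    obtain x y where x: "x \<in> U" "p = neighborhood C x" and y: "y \<in> U" "q = neighborhood C y"
      using pq unfolding Cov_def by blast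
    have eq: "neighborhood C z = neighborhood C w" if "w \<in> U" "z \<in> neighborhood C w" for w z
      by (rule neighborhood_eqI[OF \<open>finite C\<close> _ assms(4)]) (use that in \<open>simp_all only: U\<close>)
    \<comment> \<open>For a common point \<open>z\<close>, \<open>neighborhood C z\<close> equals
      both \<open>p\<close> and \<open>q\<close>.\<close>
    have False if "z \<in> p" "z \<in> q" for z
      using eq[of x z] eq[of y z] x y that \<open>p \<noteq> q\<close> by blast
    then show ?thesis
      unfolding disjnt_iff by blast
  qed
  show "{} \<notin> Cov U C"
  proof
    assume "{} \<in> Cov U C"
    then obtain x where "{} = neighborhood C x"
      unfolding Cov_def by blast
    with mem_neighborhood_self[of x C] show False
      by simp
  qed
qed

end
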